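(* $$\frac{\varphi(e^{-27\pi})}{\varphi(e^{-3\pi})} = \frac13\Bigg\{1 + \frac{(16(11\sqrt3-19))^{1/9}}{\sqrt3}\Bigg(\Big(1+\frac{\sqrt3}{2\cos\frac{4\pi}{9}}\Big)^{1/3} + \Big(1+\frac{\sqrt3}{2\cos\frac{2\pi}{9}}\Big)^{1/3} + \Big(1-\frac{\sqrt3}{2\cos\frac{\pi}{9}}\Big)^{1/3}\Bigg)\Bigg\}.$$
   Context: $\varphi(q) := \sum_{n=-\infty}^\infty q^{n^2}$ for $|q|<1$. Cube and ninth roots of real numbers denote real roots. *)

theory Defs
  imports "HOL-Analysis.Analysis"
begin

(* The argument is meant to satisfy norm q < 1, where the two-sided series converges
   absolutely; outside that range the value carries no meaning. *)
definition ramanujan_phi :: "'a :: {real_normed_field, banach} \<Rightarrow> 'a" where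
  "ramanujan_phi q = (\<Sum>\<^sub>\<infinity>n\<in>(UNIV :: int set). q powi (n ^ 2))"

end

theory Submission
  imports Defs "HOL-Real_Asymp.Real_Asymp"
begin

text \<open>
  Write \<open>\<phi>\<^sub>n\<close> for \<open>\<phi>(exp(-n\<pi>))\<close>. Two facts determine the ratio: the cubic identity
  \<open>(3\<phi>(q\<^sup>9)/\<phi>(q) - 1)\<^sup>3 = 9\<phi>(q\<^sup>3)\<^sup>4/\<phi>(q)\<^sup>4 - 1\<close> and the inversion
  \<open>\<phi>(exp(-\<pi>/t)) = \<surd>t \<phi>(exp(-\<pi>t))\<close>. Since \<open>\<phi>\<close> at \<open>exp(-\<pi>/3)\<close> is \<open>\<surd>3 \<phi>\<^sub>3\<close>, the cubic identity at
  \<open>q = exp(-\<pi>/3)\<close>, \<open>exp(-\<pi>)\<close> and \<open>exp(-3\<pi>)\<close> gives \<open>\<phi>\<^sub>1/\<phi>\<^sub>3\<close>, \<open>\<phi>\<^sub>9/\<phi>\<^sub>1\<close> and \<open>\<phi>\<^sub>2\<^sub>7/\<phi>\<^sub>3\<close> in turn.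

  The cubic identity says that the sublattice of \<open>\<int>\<^sup>4\<close> obtained from the ternary tetracode by
  construction A is a copy of \<open>\<int>\<^sup>4\<close> scaled by \<open>\<surd>3\<close>: the tetracode has weight enumerator
  \<open>a\<^sup>4 + 8ab\<^sup>3\<close>, with \<open>a\<close> and \<open>b\<close> the sums of \<open>q\<close> to the power \<open>n\<^sup>2\<close> over \<open>n \<equiv> 0\<close> and over
  \<open>n \<equiv> 1\<close> modulo 3. The inversion is Polya's limit of the evaluation of the sum of
  \<open>(2 cos(\<pi>j/N))\<close> to the power \<open>2m\<close> by binomial coefficients, taken with \<open>m\<close> of order \<open>N\<^sup>2\<close>.

  What remains is to denest the sum \<open>S\<close> of three cube roots. The radicands are the roots of
  \<open>u\<^sup>3 - (3+3\<surd>3)u\<^sup>2 + (3+6\<surd>3)u - 1\<close>; if \<open>P\<close> is the second elementary symmetric function of the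
  cube roots, then \<open>T = SP\<close> satisfies \<open>S\<^sup>3 = 3\<surd>3 + 3T\<close> and \<open>T\<^sup>3 - 9T\<^sup>2 - 27\<surd>3 T - 54 = 0\<close>, whose only
  positive root is \<open>3 + 3a + 3a\<^sup>2/2\<close> with \<open>a\<^sup>3 = 2(\<surd>3+1)\<close>.
\<close>

section \<open>Power sums of cosines\<close>

lemma two_cos_power_even:
  fixes x :: real
  shows "(2 * cos x) ^ (2 * m) =
    (\<Sum>i\<le>2*m. real (2 * m choose i) * cos (2 * (real i - real m) * x))"
proof -
  have two_cos: "complex_of_real (2 * cos x) = cis x + cis (- x)"
    by (simp add: complex_eq_iff)
  have "complex_of_real ((2 * cos x) ^ (2 * m)) = (cis x + cis (- x)) ^ (2 * m)"
    by (simp only: of_real_power two_cos)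
  also have "\<dots> = (\<Sum>i\<le>2*m. of_nat (2 * m choose i) * cis x ^ i * cis (- x) ^ (2 * m - i))"
    by (rule binomial_ring)
  also have "\<dots> = (\<Sum>i\<le>2*m. of_nat (2 * m choose i) * cis (2 * (real i - real m) * x))"
  proof (rule sum.cong[OF refl])
    fix i assume "i \<in> {..2*m}"
    then have "real (2 * m - i) = 2 * real m - real i" by auto
    then show "of_nat (2 * m choose i) * cis x ^ i * cis (- x) ^ (2 * m - i) =
        of_nat (2 * m choose i) * cis (2 * (real i - real m) * x)"
      by (simp add: Complex.DeMoivre cis_mult mult.assoc algebra_simps)
  qed
  finally have "Re (complex_of_real ((2 * cos x) ^ (2 * m))) = Re \<dots>" by simp
  then show ?thesis by simp
qed

text \<open>Orthogonality of the \<open>N\<close>-th roots of unity: a geometric sum with ratio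
  \<open>z\<close> satisfying \<open>z ^ N = 1\<close> vanishes unless \<open>z = 1\<close>.\<close>

lemma sum_cos_multiples:
  fixes d :: int
  assumes "N > 0"
  shows "(\<Sum>j<N. cos (2 * pi * d * real j / N)) = (if int N dvd d then real N else 0)"
proof -
  define z where "z = cis (2 * pi * d / N)"
  have zj: "z ^ j = cis (2 * pi * d * real j / N)" for j
    by (simp add: z_def Complex.DeMoivre mult_ac)
  have zN: "z ^ N = 1"
    using assms by (simp add: zj)
  have sum_re: "(\<Sum>j<N. cos (2 * pi * d * real j / N)) = Re (\<Sum>j<N. z ^ j)"
    by (simp add: zj)
  show ?thesis
  proof (cases "int N dvd d")
    case True
    then obtain e where "d = int N * e" by blast
    then have "2 * pi * d / N = 2 * pi * e" using assms by simp
    then have "z = 1" by (simp only: z_def cis_multiple_2pi[OF Ints_of_int])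
    then show ?thesis using True sum_re by simp
  next
    case False
    have "z \<noteq> 1"
    proof
      assume "z = 1"
      then have "cos (2 * pi * d / N) = 1" by (simp add: z_def complex_eq_iff)
      then obtain n :: int where "2 * pi * d / N = real_of_int n * 2 * pi"
        using cos_one_2pi_int by blast
      then have "real_of_int d = real_of_int (n * int N)" using assms by (simp add: field_simps)
      then have "d = n * int N" by linarith
      then show False using False by simp
    qed
    then have "(\<Sum>j<N. z ^ j) = 0" by (simp add: geometric_sum zN)
    then show ?thesis using False sum_re by simp
  qed
qed

text \<open>Averaging the binomial expansion over \<open>j\<close> acts as a roots-of-unity filter
  and keeps only the indices congruent to \<open>m\<close> modulo \<open>N\<close>.\<close>

lemma sum_two_cos_power:
  assumes "N > 0"
  shows "(\<Sum>j<N. (2 * cos (pi * real j / real N)) ^ (2 * m)) =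
    real N * (\<Sum>i | i \<le> 2 * m \<and> int N dvd int i - int m. real (2 * m choose i))"
proof -
  have "(\<Sum>j<N. (2 * cos (pi * real j / real N)) ^ (2 * m)) =
      (\<Sum>j<N. \<Sum>i\<le>2*m. real (2 * m choose i) * cos (2 * pi * (int i - int m) * real j / N))"
    unfolding two_cos_power_even
    by (intro sum.cong refl arg_cong2[of _ _ _ _ "(*)"] arg_cong[of _ _ cos]) (simp add: field_simps)
  also have "\<dots> = (\<Sum>i\<le>2*m. real (2 * m choose i) * (\<Sum>j<N. cos (2 * pi * (int i - int m) * real j / N)))"
    by (subst sum.swap) (simp only: sum_distrib_left)
  also have "\<dots> = (\<Sum>i\<le>2*m. if int N dvd int i - int m then real N * real (2 * m choose i) else 0)"
    by (intro sum.cong refl, subst sum_cos_multiples[OF assms]) simp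
  also have "\<dots> = (\<Sum>i | i \<le> 2 * m \<and> int N dvd int i - int m. real N * real (2 * m choose i))"
    by (simp add: sum.inter_filter[symmetric])
  finally show ?thesis by (simp add: sum_distrib_left)
qed

lemma sum_symmetric_split:
  fixes f :: "nat \<Rightarrow> real"
  assumes "\<And>d. d \<le> m \<Longrightarrow> f (m - d) = f (m + d)"
  shows "(\<Sum>i\<le>2*m. f i) = f m + 2 * (\<Sum>d=1..m. f (m + d))"
proof -
  have "(\<Sum>i\<le>2*m. f i) = (\<Sum>i<m. f i) + f m + (\<Sum>i\<in>{m<..2*m}. f i)"
  proof -
    have "{..2*m} = {..<m} \<union> {m} \<union> {m<..2*m}" by auto
    then show ?thesis by (simp only:, subst sum.union_disjoint) (auto simp: add.commute)
  qed
  also have "(\<Sum>i<m. f i) = (\<Sum>d=1..m. f (m - d))"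
    by (rule sum.reindex_bij_witness[of _ "\<lambda>d. m - d" "\<lambda>i. m - i"]) auto
  also have "\<dots> = (\<Sum>d=1..m. f (m + d))" using assms by simp
  also have "(\<Sum>i\<in>{m<..2*m}. f i) = (\<Sum>d=1..m. f (m + d))"
    by (rule sum.reindex_bij_witness[of _ "\<lambda>d. m + d" "\<lambda>i. i - m"]) auto
  finally show ?thesis by simp
qed

text \<open>Folding at the centre \<open>m\<close> leaves the multiples of \<open>N\<close> to its
  right. They are written as an infinite series, with only finitely many nonzero terms, because the
  later limit is taken termwise over all \<open>k\<close>.\<close>

lemma sum_binomial_progression:
  assumes "N > 0"
  shows "(\<Sum>i | i \<le> 2 * m \<and> int N dvd int i - int m. real (2 * m choose i)) =
    real (2 * m choose m) + 2 * (\<Sum>k. real (2 * m choose (m + Suc k * N)))"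
proof -
  let ?f = "\<lambda>i. if int N dvd int i - int m then real (2 * m choose i) else 0"
  have "(\<Sum>i | i \<le> 2 * m \<and> int N dvd int i - int m. real (2 * m choose i)) = (\<Sum>i\<le>2*m. ?f i)"
    by (simp add: sum.inter_filter[symmetric])
  also have "\<dots> = ?f m + 2 * (\<Sum>d=1..m. ?f (m + d))"
  proof (rule sum_symmetric_split)
    fix d assume "d \<le> m"
    then have "2 * m choose (m - d) = 2 * m choose (m + d)"
      by (subst binomial_symmetric) (auto simp: mult_2)
    then show "?f (m - d) = ?f (m + d)" using \<open>d \<le> m\<close> by simp
  qed
  also have "(\<Sum>d=1..m. ?f (m + d)) = (\<Sum>d\<in>{d\<in>{1..m}. N dvd d}. real (2 * m choose (m + d)))"
    by (simp add: sum.inter_filter[symmetric])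
  also have "\<dots> = (\<Sum>k\<in>{k. Suc k * N \<le> m}. real (2 * m choose (m + Suc k * N)))"
  proof (rule sum.reindex_bij_witness[of _ "\<lambda>k. Suc k * N" "\<lambda>d. d div N - 1"])
    fix d assume "d \<in> {d\<in>{1..m}. N dvd d}"
    then have "Suc (d div N - 1) * N = d"
      using assms by (auto simp: dvd_div_mult_self elim!: dvdE simp del: mult_Suc)
    then show "Suc (d div N - 1) * N = d" "d div N - 1 \<in> {k. Suc k * N \<le> m}"
      "real (2 * m choose (m + Suc (d div N - 1) * N)) = real (2 * m choose (m + d))"
      using \<open>d \<in> _\<close> by (auto simp del: mult_Suc)
  qed (use assms in \<open>auto simp del: mult_Suc\<close>)
  also have "\<dots> = (\<Sum>k. real (2 * m choose (m + Suc k * N)))"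
  proof (rule suminf_finite[symmetric])
    have "{k. Suc k * N \<le> m} \<subseteq> {..m}"
      using assms by (auto intro: order.trans[of _ "Suc _ * N"] simp del: mult_Suc)
         (metis Suc_leD le_trans mult.right_neutral mult_le_mono2 Suc_leI One_nat_def)
    then show "finite {k. Suc k * N \<le> m}" by (rule finite_subset) simp
  qed (auto intro!: binomial_eq_0)
  finally show ?thesis by simp
qed

text \<open>The reflection of \<open>j\<close> to \<open>2*M+1-j\<close> flips the sign of the
  cosine, which the even exponent absorbs. An odd number of nodes keeps all remaining angles
  strictly below pi/2.\<close>

lemma sum_cos_power_half:
  "(\<Sum>j<2*M+1. cos (pi * real j / real (2*M+1)) ^ (2 * m)) =
    1 + 2 * (\<Sum>k. if k < M then cos (pi * real (Suc k) / real (2*M+1)) ^ (2 * m) else 0)"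
proof -
  let ?f = "\<lambda>j. cos (pi * real j / real (2*M+1)) ^ (2 * m)"
  have "{..<2*M+1} = {0} \<union> {1..M} \<union> {M+1..2*M}" by auto
  then have "(\<Sum>j<2*M+1. ?f j) = ?f 0 + (\<Sum>j\<in>{1..M}. ?f j) + (\<Sum>j\<in>{M+1..2*M}. ?f j)"
    by (simp only:, subst sum.union_disjoint) auto
  also have "(\<Sum>j\<in>{M+1..2*M}. ?f j) = (\<Sum>j\<in>{1..M}. ?f j)"
  proof (rule sum.reindex_bij_witness[of _ "\<lambda>j. 2*M+1-j" "\<lambda>j. 2*M+1-j"])
    fix j assume "j \<in> {M+1..2*M}"
    then have "pi * real (2*M+1-j) / real (2*M+1) = pi - pi * real j / real (2*M+1)"
      by (simp add: field_simps of_nat_diff)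
    then show "?f (2*M+1-j) = ?f j" by simp
  qed auto
  also have "(\<Sum>j\<in>{1..M}. ?f j) = (\<Sum>k<M. ?f (Suc k))"
    by (rule sum.reindex_bij_witness[of _ Suc "\<lambda>j. j - 1"]) auto
  also have "\<dots> = (\<Sum>k<M. if k < M then ?f (Suc k) else 0)" by simp
  also have "\<dots> = (\<Sum>k. if k < M then ?f (Suc k) else 0)"
    by (rule suminf_finite[symmetric]) auto
  finally show ?thesis by simp
qed

text \<open>An exact link between the central coefficient and the partial Wallis products; it yields
  the square-root asymptotics of the coefficient from Wallis's limit pi/2.\<close>

lemma central_binomial_wallis:
  "(real (2 * m choose m) / 4 ^ m)\<^sup>2 * (2 * real m + 1) *
     (\<Prod>k=1..m. (4 * real k ^ 2) / (4 * real k ^ 2 - 1)) = 1"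
proof (induction m)
  case (Suc m)
  define b where "b = real (2 * m choose m) / 4 ^ m"
  define W where "W = (\<Prod>k=1..m. (4 * real k ^ 2) / (4 * real k ^ 2 - 1))"
  \<comment> \<open>Two absorption steps, one per increment of the upper index, give the recurrence
    between consecutive central coefficients.\<close>
  have "Suc m * Suc m * (2 * Suc m choose Suc m) = (2 * m + 2) * (2 * m + 1) * (2 * m choose m)"
  proof -
    have "Suc m * (2 * Suc m choose Suc m) = (2 * m + 2) * (2 * m + 1 choose m)"
      using Suc_times_binomial_eq[of "2*m+1" m] by (simp add: mult_ac)
    moreover have "Suc m * (2 * m + 1 choose m) = (2 * m + 1) * (2 * m choose m)"
    proof -
      have "2 * m + 1 choose m = 2 * m + 1 choose Suc m"
        by (subst binomial_symmetric) auto
      then show ?thesis using Suc_times_binomial_eq[of "2*m" m] by (simp add: mult_ac)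
    qed
    ultimately show ?thesis by (metis mult.assoc mult.left_commute)
  qed
  then have "real (Suc m * Suc m * (2 * Suc m choose Suc m)) =
      real ((2 * m + 2) * (2 * m + 1) * (2 * m choose m))" by (rule arg_cong)
  then have "real (2 * Suc m choose Suc m) / 4 ^ Suc m =
      b * (2 * real m + 1) / (2 * (real m + 1))"
  proof -
    assume eq: "real (Suc m * Suc m * (2 * Suc m choose Suc m)) =
      real ((2 * m + 2) * (2 * m + 1) * (2 * m choose m))"
    define B where "B = real (2 * Suc m choose Suc m)"
    define A where "A = real (2 * m choose m)"
    define s where "s = real m + 1"
    have "s > 0" by (simp add: s_def)
    have "s * (s * B) = s * (2 * (2 * real m + 1) * A)"
      using eq unfolding of_nat_mult A_def[symmetric] B_def[symmetric]
      by (simp add: s_def algebra_simps)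
    then have "s * B = 2 * (2 * real m + 1) * A" using \<open>s > 0\<close> by simp
    then have "B = 2 * (2 * real m + 1) * A / s" using \<open>s > 0\<close> by (simp add: field_simps)
    then have "B / (4 * 4 ^ m) = A / 4 ^ m * (2 * real m + 1) / (2 * s)"
      using \<open>s > 0\<close> by (simp add: divide_simps)
    then show ?thesis
      unfolding b_def A_def[symmetric] B_def[symmetric] s_def by simp
  qed
  moreover have "4 * real (Suc m) ^ 2 - 1 = (2 * real m + 1) * (2 * real m + 3)"
    by (simp add: power2_eq_square algebra_simps)
  ultimately have "(real (2 * Suc m choose Suc m) / 4 ^ Suc m)\<^sup>2 * (2 * real (Suc m) + 1) *
     (\<Prod>k=1..Suc m. (4 * real k ^ 2) / (4 * real k ^ 2 - 1)) =
     (b * (2 * real m + 1) / (2 * (real m + 1)))\<^sup>2 * (2 * real m + 3) *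
       (W * (4 * (real m + 1)\<^sup>2 / ((2 * real m + 1) * (2 * real m + 3))))"
    by (simp add: W_def add_ac del: binomial_Suc_Suc)
  also have "\<dots> = b\<^sup>2 * (2 * real m + 1) * W"
    by (simp add: divide_simps power2_eq_square) (simp add: algebra_simps)
  also have "\<dots> = 1" using Suc.IH by (simp only: b_def W_def)
  finally show ?case .
qed simp

section \<open>Theta inversion\<close>

lemma cos_le_exp:
  fixes x :: real
  assumes "0 \<le> x" "x \<le> pi / 2"
  shows "cos x \<le> exp (- x\<^sup>2 / 2)"
proof -
  have sin_ge: "y * cos y \<le> sin y" if y: "0 \<le> y" "y \<le> pi / 2" for y :: real
  proof -
    have "sin 0 - 0 * cos 0 \<le> sin y - y * cos y"
    proof (rule DERIV_nonneg_imp_nondecreasing[OF y(1)])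
      fix u :: real assume u: "0 \<le> u" "u \<le> y"
      have "((\<lambda>v. sin v - v * cos v) has_real_derivative u * sin u) (at u)"
        by (auto intro!: derivative_eq_intros)
      moreover have "u * sin u \<ge> 0" using u y by (simp add: sin_ge_zero)
      ultimately show "\<exists>D. ((\<lambda>v. sin v - v * cos v) has_real_derivative D) (at u) \<and> 0 \<le> D"
        by blast
    qed
    then show ?thesis by simp
  qed
  \<comment> \<open>This product decreases on the interval: its derivative has the sign of
    \<open>u * cos u - sin u\<close>, which is nonpositive by \<open>sin_ge\<close>.\<close>
  have "cos x * exp (x\<^sup>2 / 2) \<le> cos 0 * exp (0\<^sup>2 / 2)"
  proof (rule DERIV_nonpos_imp_nonincreasing[OF assms(1)])
    fix u :: real assume u: "0 \<le> u" "u \<le> x"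
    have "((\<lambda>v. cos v * exp (v\<^sup>2 / 2)) has_real_derivative
        exp (u\<^sup>2 / 2) * (u * cos u - sin u)) (at u)"
      by (auto intro!: derivative_eq_intros simp: algebra_simps)
    moreover have "exp (u\<^sup>2 / 2) * (u * cos u - sin u) \<le> 0"
      using sin_ge[of u] u assms by (simp add: mult_nonneg_nonpos)
    ultimately show "\<exists>D. ((\<lambda>v. cos v * exp (v\<^sup>2 / 2)) has_real_derivative D) (at u) \<and> D \<le> 0"
      by blast
  qed
  then show ?thesis by (simp add: exp_minus field_simps)
qed

text \<open>Normalising by the central coefficient isolates the Gaussian profile in
  \<open>d\<close>; the central coefficient itself is treated through Wallis.\<close>

definition binom_ratio :: "nat \<Rightarrow> nat \<Rightarrow> real" where
  "binom_ratio m d = real (2 * m choose (m + d)) / real (2 * m choose m)"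

lemma binom_ratio_Suc:
  assumes "d \<le> m"
  shows "binom_ratio m (Suc d) = binom_ratio m d * ((real m - real d) / (real m + real d + 1))"
proof -
  have "(2 * m choose Suc (m + d)) * Suc (m + d) = (2 * m choose (m + d)) * (m - d)"
  proof (cases m)
    case (Suc n)
    then have "(2 * m choose Suc (m + d)) * Suc (m + d) = 2 * m * (2 * m - 1 choose (m + d))"
      using Suc_times_binomial[of "m + d" "2 * m - 1"] by (simp add: mult.commute)
    also have "\<dots> = (2 * m - (m + d)) * (2 * m choose (m + d))"
      using binomial_absorb_comp[of "2 * m" "m + d"] by simp
    also have "2 * m - (m + d) = m - d" by simp
    finally show ?thesis by (simp add: mult.commute)
  qed (use assms in simp)
  then have "real ((2 * m choose Suc (m + d)) * Suc (m + d)) = real ((2 * m choose (m + d)) * (m - d))"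
    by (rule arg_cong)
  then have "real (2 * m choose Suc (m + d)) = real (2 * m choose (m + d)) * ((real m - real d) / (real m + real d + 1))"
    using assms by (simp add: of_nat_diff field_simps)
  then show ?thesis by (simp add: binom_ratio_def)
qed

lemma binom_ratio_nonneg: "binom_ratio m d \<ge> 0"
  by (simp add: binom_ratio_def)

text \<open>Each factor of the telescoping product is 1/(1+y) with y = (2e+1)/(m-e), hence at least
  exp(-y), and the odd numbers 2e+1 add up to a square. The fixed bound \<open>d\<close> gives all
  exponents one common denominator.\<close>

lemma binom_ratio_ge:
  assumes "e \<le> d" "d < m"
  shows "exp (- ((real e)\<^sup>2 / (real m - real d))) \<le> binom_ratio m e"
  using assms(1)
proof (induction e)
  case (Suc e)
  let ?q = "(real m - real e) / (real m + real e + 1)"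
  define y where "y = (2 * real e + 1) / (real m - real e)"
  have me: "real m - real e > 0" using Suc.prems assms by simp
  have "1 + y \<le> exp y" by (rule exp_ge_add_one_self)
  moreover have "1 + y > 0" using me by (simp add: y_def add_pos_nonneg)
  ultimately have "exp (- y) \<le> 1 / (1 + y)" by (simp add: exp_minus field_simps)
  also have "1 / (1 + y) = ?q" using me by (simp add: y_def field_simps)
  finally have q: "exp (- y) \<le> ?q" .
  have "y \<le> (2 * real e + 1) / (real m - real d)"
    unfolding y_def using Suc.prems assms by (intro divide_left_mono) auto
  then have "exp (- ((2 * real e + 1) / (real m - real d))) \<le> exp (- y)" by simp
  from order.trans[OF this q]
  have "exp (- ((real e)\<^sup>2 / (real m - real d))) * exp (- ((2 * real e + 1) / (real m - real d)))
      \<le> binom_ratio m e * ?q"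
    by (intro mult_mono Suc.IH binom_ratio_nonneg) (use Suc.prems in auto)
  moreover have "(real (Suc e))\<^sup>2 / (real m - real d) =
      (real e)\<^sup>2 / (real m - real d) + (2 * real e + 1) / (real m - real d)"
    by (simp add: power2_eq_square algebra_simps flip: add_divide_distrib)
  ultimately show ?case
    using me by (simp add: binom_ratio_Suc mult_exp_exp)
qed (simp add: binom_ratio_def)

text \<open>The counterpart from above: each factor is 1 - (2e+1)/(m+e+1), and 1 - y is at most
  exp(-y).\<close>

lemma binom_ratio_le:
  assumes "e \<le> d" "d \<le> m"
  shows "binom_ratio m e \<le> exp (- ((real e)\<^sup>2 / (real m + real d)))"
  using assms(1)
proof (induction e)
  case (Suc e)
  let ?q = "(real m - real e) / (real m + real e + 1)"
  have me: "real m - real e > 0" using Suc.prems assms by simp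
  have "?q = 1 + (- ((2 * real e + 1) / (real m + real e + 1)))" by (simp add: field_simps)
  also have "\<dots> \<le> exp (- ((2 * real e + 1) / (real m + real e + 1)))" by (rule exp_ge_add_one_self)
  also have "\<dots> \<le> exp (- ((2 * real e + 1) / (real m + real d)))"
    using Suc.prems by (simp add: frac_le)
  finally have "binom_ratio m e * ?q
      \<le> exp (- ((real e)\<^sup>2 / (real m + real d))) * exp (- ((2 * real e + 1) / (real m + real d)))"
    using Suc me by (intro mult_mono) auto
  moreover have "(real (Suc e))\<^sup>2 / (real m + real d) =
      (real e)\<^sup>2 / (real m + real d) + (2 * real e + 1) / (real m + real d)"
    by (simp add: power2_eq_square algebra_simps flip: add_divide_distrib)
  ultimately show ?case
    using me by (simp add: binom_ratio_Suc mult_exp_exp)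
qed (simp add: binom_ratio_def)

lemma binom_ratio_le_exp: "binom_ratio m d \<le> exp (- ((real d)\<^sup>2 / (2 * real m)))"
proof (cases "d \<le> m")
  case True
  show ?thesis
  proof (cases "m = 0")
    case False
    have "binom_ratio m d \<le> exp (- ((real d)\<^sup>2 / (real m + real d)))"
      using True by (intro binom_ratio_le) auto
    also have "\<dots> \<le> exp (- ((real d)\<^sup>2 / (2 * real m)))"
      using True False by (simp add: frac_le)
    finally show ?thesis .
  qed (use True in \<open>simp add: binom_ratio_def\<close>)
qed (simp add: binom_ratio_def binomial_eq_0)

text \<open>Tannery's theorem asks for its majorant on a product filter; a bound uniform in
  \<open>k\<close> supplies this.\<close>

lemma eventually_prod_all:
  assumes "\<forall>\<^sub>F n in F. \<forall>k. Q k n"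
  shows "\<forall>\<^sub>F (k, n) in G \<times>\<^sub>F F. Q k n"
  unfolding eventually_prod_filter
  by (rule exI[of _ "\<lambda>_. True"], rule exI[of _ "\<lambda>n. \<forall>k. Q k n"]) (use assms in auto)

lemma summable_exp_neg_Suc: "a > 0 \<Longrightarrow> summable (\<lambda>k. exp (- a) ^ Suc k)" for a :: real
  by (subst summable_Suc_iff) (auto intro!: summable_geometric)

section \<open>Polya's limit: odd \<open>N\<close> tending to infinity with \<open>m\<close> close
  to \<open>s * N^2\<close>\<close>

context
  fixes s :: real and m :: "nat \<Rightarrow> nat" and N :: "nat \<Rightarrow> nat"
  assumes s: "s > 0"
  defines "N \<equiv> \<lambda>M. 2 * M + 1"
  defines "m \<equiv> \<lambda>M. nat \<lfloor>s * real (N M) ^ 2\<rfloor>"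
begin

lemma m_over_N2: "(\<lambda>M. real (m M) / real (N M) ^ 2) \<longlonglongrightarrow> s"
  using s unfolding m_def N_def by real_asymp

lemma m_at_top: "filterlim m at_top sequentially"
  using s unfolding m_def N_def by real_asymp

lemma N2_ln_cos:
  "(\<lambda>M. real (N M) ^ 2 * ln (cos (pi * real (Suc k) / real (N M)))) \<longlonglongrightarrow> - (pi * real (Suc k))\<^sup>2 / 2"
proof -
  define j where "j = pi * real (Suc k)"
  have "j > 0" by (simp add: j_def)
  have "(\<lambda>M. real (2 * M + 1) ^ 2 * ln (cos (j / real (2 * M + 1)))) \<longlonglongrightarrow> - (j * j / 2)"
    using \<open>j > 0\<close> by real_asymp
  moreover have "- (pi * real (Suc k))\<^sup>2 / 2 = - (j * j / 2)" by (simp add: j_def power2_eq_square)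
  ultimately show ?thesis by (simp only: N_def j_def)
qed


text \<open>The power is exp(2 (m/N^2) (N^2 ln cos)), and ln(cos x) behaves like -x^2/2 near 0.
  Since \<open>k < M\<close>, the angle stays below pi/2 and the logarithm is taken of a positive
  number.\<close>

lemma cos_term_tendsto:
  "(\<lambda>M. if k < M then cos (pi * real (Suc k) / real (N M)) ^ (2 * m M) else 0)
    \<longlonglongrightarrow> exp (- (pi\<^sup>2 * s * (real (Suc k))\<^sup>2))"
proof -
  let ?c = "\<lambda>M. cos (pi * real (Suc k) / real (N M))"
  have "(\<lambda>M. exp (2 * (real (m M) / real (N M) ^ 2) * (real (N M) ^ 2 * ln (?c M))))
      \<longlonglongrightarrow> exp (2 * s * (- (pi * real (Suc k))\<^sup>2 / 2))"
    by (intro tendsto_intros m_over_N2 N2_ln_cos)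
  moreover have "\<forall>\<^sub>F M in sequentially.
      exp (2 * (real (m M) / real (N M) ^ 2) * (real (N M) ^ 2 * ln (?c M))) =
      (if k < M then ?c M ^ (2 * m M) else 0)"
    using eventually_gt_at_top[of k]
  proof eventually_elim
    case (elim M)
    have "N M > 0" by (simp add: N_def)
    have "real (Suc k) / real (N M) < 1 / 2"
      using elim by (simp add: N_def field_simps)
    then have "pi * real (Suc k) / real (N M) < pi / 2"
      using mult_strict_left_mono[OF _ pi_gt_zero, of "real (Suc k) / real (N M)" "1 / 2"]
      by (simp only: times_divide_eq_right mult_1_right)
    then have "?c M > 0"
      by (intro cos_gt_zero_pi) (auto intro: less_le_trans[of _ 0])
    then have "?c M ^ (2 * m M) = exp (real (2 * m M) * ln (?c M))"
      by (simp only: exp_of_nat_mult exp_ln)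
    then show ?case using elim \<open>N M > 0\<close> by simp
  qed
  ultimately have "(\<lambda>M. if k < M then ?c M ^ (2 * m M) else 0)
      \<longlonglongrightarrow> exp (2 * s * (- (pi * real (Suc k))\<^sup>2 / 2))"
    by (rule Lim_transform_eventually)
  then show ?thesis by (simp only: power_mult_distrib) (simp add: mult_ac)
qed

text \<open>The Gaussian bound on the cosine becomes a geometric majorant independent of
  \<open>M\<close>, because a positive integer is at most its square.\<close>

lemma cos_term_bound:
  assumes "real (m M) / real (N M) ^ 2 \<ge> s / 2"
  shows "norm (if k < M then cos (pi * real (Suc k) / real (N M)) ^ (2 * m M) else 0)
    \<le> exp (- (pi\<^sup>2 * s / 2)) ^ Suc k"
proof (cases "k < M")
  case True
  let ?x = "pi * real (Suc k) / real (N M)"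
  have "real (Suc k) / real (N M) \<le> 1 / 2"
    using True by (simp add: N_def field_simps)
  then have x: "0 \<le> ?x" "?x \<le> pi / 2"
    using mult_left_mono[OF _ pi_ge_zero, of "real (Suc k) / real (N M)" "1 / 2"]
    by (simp_all only: times_divide_eq_right mult_1_right) simp
  have "cos ?x ^ (2 * m M) \<le> exp (- ?x\<^sup>2 / 2) ^ (2 * m M)"
  proof (intro power_mono cos_le_exp cos_ge_zero x)
    show "- (pi / 2) \<le> ?x" using x(1) pi_ge_zero by linarith
  qed
  also have "\<dots> = exp (- (pi\<^sup>2 * (real (m M) / real (N M) ^ 2) * (real (Suc k))\<^sup>2))"
    unfolding exp_of_nat_mult[symmetric] by (simp add: power_divide power_mult_distrib)
  also have "\<dots> \<le> exp (- (pi\<^sup>2 * (s / 2) * real (Suc k)))"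
    using assms s by (intro exp_mono le_imp_neg_le mult_mono) (auto simp: power2_eq_square)
  also have "\<dots> = exp (- (pi\<^sup>2 * s / 2)) ^ Suc k"
    unfolding exp_of_nat_mult[symmetric] by (simp add: mult_ac)
  finally show ?thesis using True by simp
qed simp

text \<open>At distance d = jN from the centre the two bounds have exponents d^2/(m-d) and
  d^2/(m+d). Dividing through by N^2 shows that both tend to j^2/s.\<close>

lemma binom_term_tendsto:
  "(\<lambda>M. binom_ratio (m M) (Suc k * N M)) \<longlonglongrightarrow> exp (- (1 / s * (real (Suc k))\<^sup>2))"
proof -
  define j where "j = real (Suc k)"
  let ?r = "\<lambda>M. real (m M) / real (N M) ^ 2"
  have N0: "N M > 0" for M by (simp add: N_def)
  have jN: "(\<lambda>M. j / real (N M)) \<longlonglongrightarrow> 0" unfolding N_def by real_asymp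
  have lo: "(\<lambda>M. exp (- (j\<^sup>2 / (?r M - j / real (N M))))) \<longlonglongrightarrow> exp (- (j\<^sup>2 / (s - 0)))"
    using s by (intro tendsto_intros m_over_N2 jN) auto
  have hi: "(\<lambda>M. exp (- (j\<^sup>2 / (?r M + j / real (N M))))) \<longlonglongrightarrow> exp (- (j\<^sup>2 / (s + 0)))"
    using s by (intro tendsto_intros m_over_N2 jN) auto
  have "(\<lambda>M. ?r M - j / real (N M)) \<longlonglongrightarrow> s - 0" by (intro tendsto_intros m_over_N2 jN)
  then have "\<forall>\<^sub>F M in sequentially. ?r M - j / real (N M) > 0"
    using s by (intro order_tendstoD) auto
  then have ev: "\<forall>\<^sub>F M in sequentially.
      exp (- (j\<^sup>2 / (?r M - j / real (N M)))) \<le> binom_ratio (m M) (Suc k * N M) \<and>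
      binom_ratio (m M) (Suc k * N M) \<le> exp (- (j\<^sup>2 / (?r M + j / real (N M))))"
  proof eventually_elim
    case (elim M)
    let ?n = "real (N M)"
    have n: "?n > 0" using N0 by simp
    have "?r M - j / ?n = (real (m M) - j * ?n) / ?n\<^sup>2"
      using n by (simp add: field_simps power2_eq_square)
    then have pos: "real (m M) - j * ?n > 0" using elim n by (simp add: zero_less_divide_iff)
    then have "real (Suc k * N M) < real (m M)" by (simp only: j_def of_nat_mult)
    then have lt: "Suc k * N M < m M" by (simp only: of_nat_less_iff)
    have "- ((real (Suc k * N M))\<^sup>2 / (real (m M) - real (Suc k * N M))) = - (j\<^sup>2 / (?r M - j / ?n))"
      unfolding of_nat_mult j_def[symmetric] using n pos
      by (simp add: divide_simps power2_eq_square)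
    moreover have "- ((real (Suc k * N M))\<^sup>2 / (real (m M) + real (Suc k * N M))) = - (j\<^sup>2 / (?r M + j / ?n))"
      unfolding of_nat_mult j_def[symmetric] using n pos
      by (simp add: divide_simps power2_eq_square)
    ultimately show ?case
      using binom_ratio_ge[OF order.refl lt] binom_ratio_le[OF order.refl less_imp_le[OF lt]] by simp
  qed
  have "(\<lambda>M. binom_ratio (m M) (Suc k * N M)) \<longlonglongrightarrow> exp (- (j\<^sup>2 / s))"
    by (rule tendsto_sandwich[OF _ _ lo[simplified] hi[simplified]])
       (use ev in \<open>auto elim: eventually_mono\<close>)
  then show ?thesis by (simp add: j_def)
qed

lemma binom_term_bound:
  assumes "m M > 0" "real (m M) / real (N M) ^ 2 \<le> 2 * s"
  shows "norm (binom_ratio (m M) (Suc k * N M)) \<le> exp (- (1 / (4 * s))) ^ Suc k"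
proof -
  let ?n = "real (N M)"
  have n: "?n > 0" by (simp add: N_def)
  have eq: "(real (Suc k * N M))\<^sup>2 / (2 * real (m M)) =
      (real (Suc k))\<^sup>2 * (1 / (2 * (real (m M) / ?n\<^sup>2)))"
    unfolding of_nat_mult power_mult_distrib using n assms(1) by (simp add: field_simps del: of_nat_Suc)
  have "binom_ratio (m M) (Suc k * N M) \<le> exp (- ((real (Suc k * N M))\<^sup>2 / (2 * real (m M))))"
    by (rule binom_ratio_le_exp)
  also have "\<dots> = exp (- ((real (Suc k))\<^sup>2 * (1 / (2 * (real (m M) / ?n\<^sup>2)))))"
    by (simp only: eq)
  also have "\<dots> \<le> exp (- (real (Suc k) * (1 / (2 * (2 * s)))))"
  proof -
    have "1 / (2 * (2 * s)) \<le> 1 / (2 * (real (m M) / ?n\<^sup>2))"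
      using assms n s by (intro divide_left_mono) auto
    moreover have "real (Suc k) \<le> (real (Suc k))\<^sup>2" by (simp add: power2_eq_square)
    ultimately show ?thesis using s by (intro exp_mono le_imp_neg_le mult_mono) auto
  qed
  also have "\<dots> = exp (- (1 / (4 * s))) ^ Suc k"
    unfolding exp_of_nat_mult[symmetric] by simp
  finally show ?thesis by (simp add: binom_ratio_def)
qed

lemma cos_series_tendsto:
  "(\<lambda>M. \<Sum>k. if k < M then cos (pi * real (Suc k) / real (N M)) ^ (2 * m M) else 0)
    \<longlonglongrightarrow> (\<Sum>k. exp (- (pi\<^sup>2 * s * (real (Suc k))\<^sup>2)))"
proof -
  have "\<forall>\<^sub>F M in sequentially. s / 2 < real (m M) / real (N M) ^ 2"
    by (rule order_tendstoD[OF m_over_N2]) (use s in simp)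
  then have ev: "\<forall>\<^sub>F M in sequentially. \<forall>k.
      norm (if k < M then cos (pi * real (Suc k) / real (N M)) ^ (2 * m M) else 0)
        \<le> exp (- (pi\<^sup>2 * s / 2)) ^ Suc k"
    by eventually_elim (intro allI cos_term_bound less_imp_le)
  have "\<forall>\<^sub>F (k, M) in at_top \<times>\<^sub>F sequentially.
      norm (if k < M then cos (pi * real (Suc k) / real (N M)) ^ (2 * m M) else 0)
        \<le> exp (- (pi\<^sup>2 * s / 2)) ^ Suc k"
    by (rule eventually_prod_all[OF ev])
  from tannerys_theorem[OF cos_term_tendsto this summable_exp_neg_Suc] s
  show ?thesis by simp
qed

lemma binom_series_tendsto:
  "(\<lambda>M. \<Sum>k. binom_ratio (m M) (Suc k * N M)) \<longlonglongrightarrow> (\<Sum>k. exp (- (1 / s * (real (Suc k))\<^sup>2)))"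
proof -
  have "\<forall>\<^sub>F M in sequentially. real (m M) / real (N M) ^ 2 < 2 * s"
    by (rule order_tendstoD[OF m_over_N2]) (use s in simp)
  moreover have "\<forall>\<^sub>F M in sequentially. m M > 0"
    using m_at_top by (rule eventually_compose_filterlim[OF eventually_gt_at_top])
  ultimately have ev: "\<forall>\<^sub>F M in sequentially. \<forall>k.
      norm (binom_ratio (m M) (Suc k * N M)) \<le> exp (- (1 / (4 * s))) ^ Suc k"
    by eventually_elim (intro allI binom_term_bound, auto)
  have "\<forall>\<^sub>F (k, M) in at_top \<times>\<^sub>F sequentially.
      norm (binom_ratio (m M) (Suc k * N M)) \<le> exp (- (1 / (4 * s))) ^ Suc k"
    by (rule eventually_prod_all[OF ev])
  from tannerys_theorem[OF binom_term_tendsto this summable_exp_neg_Suc] s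
  show ?thesis by simp
qed

text \<open>By the Wallis identity the square of the term is 1/((2m/N^2 + 1/N^2) W) with W tending
  to pi/2, so it tends to 1/(pi s).\<close>

lemma binom_constant_tendsto:
  "(\<lambda>M. real (N M) * (real (2 * m M choose m M) / 4 ^ m M)) \<longlonglongrightarrow> 1 / sqrt (pi * s)"
proof -
  let ?b = "\<lambda>M. real (2 * m M choose m M) / 4 ^ m M"
  let ?W = "\<lambda>n. \<Prod>k=1..n. (4 * real k ^ 2) / (4 * real k ^ 2 - 1)"
  have n0: "real (N M) > 0" for M by (simp add: N_def)
  have W: "(\<lambda>M. ?W (m M)) \<longlonglongrightarrow> pi / 2"
    by (rule filterlim_compose[OF wallis m_at_top])
  have inv: "(\<lambda>M. 1 / real (N M) ^ 2) \<longlonglongrightarrow> 0" unfolding N_def by real_asymp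
  have "(\<lambda>M. sqrt (1 / ((2 * (real (m M) / real (N M) ^ 2) + 1 / real (N M) ^ 2) * ?W (m M))))
      \<longlonglongrightarrow> sqrt (1 / ((2 * s + 0) * (pi / 2)))"
    using s by (intro tendsto_intros m_over_N2 inv W) auto
  moreover have "sqrt (1 / ((2 * (real (m M) / real (N M) ^ 2) + 1 / real (N M) ^ 2) * ?W (m M))) =
      real (N M) * ?b M" for M
  proof (rule real_sqrt_unique)
    have eq: "(?b M)\<^sup>2 * (2 * real (m M) + 1) * ?W (m M) = 1" by (rule central_binomial_wallis)
    have "u = 1 / (v * w)" if "u * v * w = 1" for u v w :: real
    proof -
      have "v * w \<noteq> 0" using that by auto
      then show ?thesis using that by (simp add: eq_divide_eq mult.assoc)
    qed
    from this[OF eq] have "(?b M)\<^sup>2 = 1 / ((2 * real (m M) + 1) * ?W (m M))" .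
    then show "(real (N M) * ?b M)\<^sup>2 =
        1 / ((2 * (real (m M) / real (N M) ^ 2) + 1 / real (N M) ^ 2) * ?W (m M))"
      using n0[of M] by (simp only: power_mult_distrib) (simp add: field_simps)
  qed simp
  ultimately show ?thesis by (simp add: real_sqrt_divide mult.commute)
qed

text \<open>Both sides are limits of the same quantity, the sum of \<open>cos(pi*j/N)^(2*m)\<close>
  over \<open>j < N\<close>: once termwise in the cosines, once through its evaluation by binomial
  coefficients.\<close>

lemma theta_series_inversion:
  "1 + 2 * (\<Sum>k. exp (- (pi\<^sup>2 * s * (real (Suc k))\<^sup>2))) =
    1 / sqrt (pi * s) * (1 + 2 * (\<Sum>k. exp (- (1 / s * (real (Suc k))\<^sup>2))))"
proof (rule LIMSEQ_unique)
  show "(\<lambda>M. 1 + 2 * (\<Sum>k. if k < M then cos (pi * real (Suc k) / real (N M)) ^ (2 * m M) else 0))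
      \<longlonglongrightarrow> 1 + 2 * (\<Sum>k. exp (- (pi\<^sup>2 * s * (real (Suc k))\<^sup>2)))"
    by (intro tendsto_intros cos_series_tendsto)
  \<comment> \<open>For each finite \<open>M\<close> the two expressions agree exactly: this is the
    cosine power sum divided by \<open>4 ^ m M\<close>, with the central coefficient factored
    out.\<close>
  have "(1 + 2 * (\<Sum>k. if k < M then cos (pi * real (Suc k) / real (N M)) ^ (2 * m M) else 0)) =
     real (N M) * (real (2 * m M choose m M) / 4 ^ m M) * (1 + 2 * (\<Sum>k. binom_ratio (m M) (Suc k * N M)))"
     (is "?L = ?R") for M
  proof -
    let ?B = "real (2 * m M choose m M)"
    have fin: "summable (\<lambda>k. real (2 * m M choose (m M + Suc k * N M)))"
    proof (rule summable_finite[of "{..m M}"])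
      fix k assume "k \<notin> {..m M}"
      then have "m M < Suc k * N M" by (simp add: N_def)
      then show "real (2 * m M choose (m M + Suc k * N M)) = 0" by (simp add: binomial_eq_0)
    qed simp
    have "4 ^ m M * ?L = (\<Sum>j<N M. (2 * cos (pi * real j / real (N M))) ^ (2 * m M))"
      unfolding N_def sum_cos_power_half[symmetric]
      by (simp only: power_mult_distrib power_mult sum_distrib_left) simp
    also have "\<dots> = real (N M) * (?B + 2 * (\<Sum>k. real (2 * m M choose (m M + Suc k * N M))))"
      by (simp only: sum_two_cos_power sum_binomial_progression N_def)
    also have "(\<Sum>k. real (2 * m M choose (m M + Suc k * N M))) =
        ?B * (\<Sum>k. binom_ratio (m M) (Suc k * N M))"
      unfolding binom_ratio_def by (subst suminf_divide[OF fin]) simp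
    finally show ?thesis by (simp add: field_simps)
  qed
  then show "(\<lambda>M. 1 + 2 * (\<Sum>k. if k < M then cos (pi * real (Suc k) / real (N M)) ^ (2 * m M) else 0))
      \<longlonglongrightarrow> 1 / sqrt (pi * s) * (1 + 2 * (\<Sum>k. exp (- (1 / s * (real (Suc k))\<^sup>2))))"
    by (simp only:) (intro tendsto_intros binom_constant_tendsto binom_series_tendsto)
qed

end

section \<open>Two-sided sums over the integers and the passage from \<open>ramanujan_phi\<close> to
  one-sided series\<close>

lemma has_sum_even_int:
  fixes f :: "int \<Rightarrow> real"
  assumes even: "\<And>n. f (- n) = f n" and summable: "summable (\<lambda>k. norm (f (int (Suc k))))"
  shows "(f has_sum (f 0 + 2 * (\<Sum>k. f (int (Suc k))))) UNIV"
proof -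
  let ?T = "\<Sum>k. f (int (Suc k))"
  have T: "((\<lambda>k. f (int (Suc k))) has_sum ?T) UNIV"
    by (rule norm_summable_imp_has_sum[OF summable summable_sums[OF summable_norm_cancel[OF summable]]])
  have pos: "(f has_sum ?T) {1..}"
    using T by (rule has_sum_reindex_bij_witness[of UNIV "\<lambda>n. nat (n - 1)" "\<lambda>k. int (Suc k)",
        THEN iffD1, rotated -1]) auto
  have neg: "(f has_sum ?T) {..-1}"
    using T by (rule has_sum_reindex_bij_witness[of UNIV "\<lambda>n. nat (- n - 1)" "\<lambda>k. - int (Suc k)",
        THEN iffD1, rotated -1]) (auto simp del: of_nat_Suc simp: even)
  have "(f has_sum (f 0 + ?T + ?T)) ({0} \<union> {1..} \<union> {..-1})"
    by (intro has_sum_Un_disjoint pos neg) (auto intro!: has_sum_finiteI)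
  also have "{0} \<union> {1..} \<union> {..-1} = (UNIV :: int set)" by auto
  finally show ?thesis by (simp only: mult_2 add.assoc)
qed

text \<open>Fubini for nonnegative terms, where the iterated sums already give summability over the
  product set.\<close>

lemma has_sum_times:
  fixes f :: "'a \<Rightarrow> real" and g :: "'b \<Rightarrow> real"
  assumes f: "(f has_sum a) A" and g: "(g has_sum b) B"
    and nonneg: "\<And>x. x \<in> A \<Longrightarrow> f x \<ge> 0" "\<And>y. y \<in> B \<Longrightarrow> g y \<ge> 0"
  shows "((\<lambda>(x, y). f x * g y) has_sum (a * b)) (A \<times> B)"
proof (rule has_sum_SigmaI)
  show "((\<lambda>y. case (x, y) of (x, y) \<Rightarrow> f x * g y) has_sum f x * b) B" for x
    using has_sum_cmult_right[OF g] by simp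
  show "((\<lambda>x. f x * b) has_sum a * b) A" by (rule has_sum_cmult_left[OF f])
  show "(\<lambda>(x, y). f x * g y) summable_on A \<times> B"
  proof (rule summable_on_SigmaI)
    show "((\<lambda>y. case (x, y) of (x, y) \<Rightarrow> f x * g y) has_sum f x * b) B" for x
      using has_sum_cmult_right[OF g] by simp
    show "(\<lambda>x. f x * b) summable_on A"
      using has_sum_cmult_left[OF f] by (rule has_sum_imp_summable)
  qed (use nonneg in auto)
qed

lemma exp_powi_square:
  fixes x :: real
  shows "exp (- x) powi (n ^ 2) = exp (- (x * (real_of_int n)\<^sup>2))"
proof -
  have "exp (- x) powi (n ^ 2) = exp (- x) ^ nat (n ^ 2)"
    by (simp add: power_int_def)
  also have "\<dots> = exp (real (nat (n ^ 2)) * - x)"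
    by (rule exp_of_nat_mult[symmetric])
  also have "real (nat (n ^ 2)) = (real_of_int n)\<^sup>2" by simp
  finally show ?thesis by (simp add: mult.commute)
qed

lemma summable_exp_square:
  fixes x :: real
  assumes "x > 0"
  shows "summable (\<lambda>k. norm (exp (- (x * (real_of_int (int (Suc k)))\<^sup>2))))"
proof (rule summable_comparison_test'[of "\<lambda>k. exp (- x) ^ Suc k" 0])
  show "summable (\<lambda>k. exp (- x) ^ Suc k)" by (rule summable_exp_neg_Suc[OF assms])
next
  fix k :: nat
  have "x * real (Suc k) \<le> x * (real (Suc k))\<^sup>2"
    using assms by (intro mult_left_mono) (auto simp: power2_eq_square)
  then show "norm (norm (exp (- (x * (real_of_int (int (Suc k)))\<^sup>2)))) \<le> exp (- x) ^ Suc k"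
    unfolding exp_of_nat_mult[symmetric] by (simp add: mult.commute)
qed

lemma has_sum_ramanujan_phi:
  fixes x :: real
  assumes "x > 0"
  shows "((\<lambda>n::int. exp (- (x * (real_of_int n)\<^sup>2))) has_sum ramanujan_phi (exp (- x))) UNIV"
    and ramanujan_phi_eq: "ramanujan_phi (exp (- x)) = 1 + 2 * (\<Sum>k. exp (- (x * (real (Suc k))\<^sup>2)))"
proof -
  have "((\<lambda>n::int. exp (- (x * (real_of_int n)\<^sup>2))) has_sum
      (1 + 2 * (\<Sum>k. exp (- (x * (real (Suc k))\<^sup>2))))) UNIV"
    using has_sum_even_int[of "\<lambda>n. exp (- (x * (real_of_int n)\<^sup>2))"] summable_exp_square[OF assms]
    by simp
  moreover from infsumI[OF this]
  show "ramanujan_phi (exp (- x)) = 1 + 2 * (\<Sum>k. exp (- (x * (real (Suc k))\<^sup>2)))"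
    by (simp add: ramanujan_phi_def exp_powi_square)
  ultimately show "((\<lambda>n::int. exp (- (x * (real_of_int n)\<^sup>2))) has_sum ramanujan_phi (exp (- x))) UNIV"
    by simp
qed

lemma ramanujan_phi_pos:
  fixes x :: real
  assumes "x > 0"
  shows "ramanujan_phi (exp (- x)) > 0"
  unfolding ramanujan_phi_eq[OF assms]
  using summable_exp_square[OF assms] by (intro add_pos_nonneg mult_nonneg_nonneg suminf_nonneg) auto

lemma ramanujan_phi_inversion:
  fixes t :: real
  assumes "t > 0"
  shows "ramanujan_phi (exp (- (pi / t))) = sqrt t * ramanujan_phi (exp (- (pi * t)))"
proof -
  \<comment> \<open>The choice s = t/pi turns the exponents pi^2 s and 1/s into pi t and pi/t, and
    the factor into 1/sqrt t.\<close>
  have "ramanujan_phi (exp (- (pi * t))) = 1 / sqrt t * ramanujan_phi (exp (- (pi / t)))"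
    using theta_series_inversion[of "t / pi"] assms by (simp add: ramanujan_phi_eq power2_eq_square mult_ac)
  then show ?thesis using assms by simp
qed

section \<open>The cubic identity\<close>

text \<open>The right-hand side is the weight enumerator \<open>a^4 + 8*a*b^3\<close> at a = Q and b
  = (P-Q)/2. Both sides evaluate the same lattice sum over \<open>L\<close>, once by residue classes
  and once by the similarity \<open>M\<close>.\<close>

lemma ramanujan_phi_quartic:
  fixes x :: real
  assumes "x > 0"
  defines "P \<equiv> ramanujan_phi (exp (- x))" and "Q \<equiv> ramanujan_phi (exp (- (9 * x)))"
  shows "ramanujan_phi (exp (- (3 * x))) ^ 4 = Q * (Q ^ 3 + (P - Q) ^ 3)"
proof -
  define e where "e = (\<lambda>n::int. exp (- (x * (real_of_int n)\<^sup>2)))"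
  define R where "R = (\<lambda>c::int. {n::int. 3 dvd n - c})"
  define S where "S = (\<lambda>c. infsum e (R c))"
  have e_pos: "e n \<ge> 0" for n by (simp add: e_def)
  have e_sum: "(e has_sum P) UNIV" unfolding e_def P_def by (rule has_sum_ramanujan_phi[OF assms(1)])
  have S: "(e has_sum S c) (R c)" for c
    unfolding S_def using e_sum by (meson has_sum_imp_summable has_sum_infsum subset_UNIV summable_on_subset_banach)
  have S_mod: "S c = S (c mod 3)" for c
  proof -
    have "R c = R (c mod 3)" unfolding R_def by (intro Collect_cong) presburger
    then show ?thesis by (simp only: S_def)
  qed
  \<comment> \<open>Negation exchanges the classes 1 and 2 modulo 3 and preserves
    \<open>e\<close>.\<close>
  have "(e has_sum S 1) (R 2)"
  proof -
    have "(e has_sum S 1) (R 1) = (e has_sum S 1) (R 2)"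
    proof (rule has_sum_reindex_bij_witness[of _ uminus uminus])
      show "- n \<in> R 2" if "n \<in> R 1" for n using that unfolding R_def mem_Collect_eq by presburger
      show "- n \<in> R 1" if "n \<in> R 2" for n using that unfolding R_def mem_Collect_eq by presburger
    qed (simp_all add: e_def)
    then show ?thesis using S by simp
  qed
  then have S2: "S 2 = S 1" using S has_sum_unique by blast
  have S0: "S 0 = Q"
  proof -
    have "((\<lambda>n::int. exp (- (9 * x * (real_of_int n)\<^sup>2))) has_sum S 0) UNIV = (e has_sum S 0) (R 0)"
      by (rule has_sum_reindex_bij_witness[of _ "\<lambda>n. n div 3" "\<lambda>n. 3 * n"])
         (auto simp: R_def e_def power2_eq_square mult_ac)
    moreover have "((\<lambda>n::int. exp (- (9 * x * (real_of_int n)\<^sup>2))) has_sum Q) UNIV"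
      unfolding Q_def using assms(1) by (intro has_sum_ramanujan_phi) simp
    ultimately show ?thesis using S has_sum_unique by blast
  qed
  have P: "P = S 0 + S 1 + S 1"
  proof -
    have "(e has_sum (S 0 + S 1 + S 2)) (R 0 \<union> R 1 \<union> R 2)"
    proof (intro has_sum_Un_disjoint S)
      show "R 0 \<inter> R 1 = {}" "(R 0 \<union> R 1) \<inter> R 2 = {}"
        unfolding R_def set_eq_iff by (simp; presburger)+
    qed
    also have "R 0 \<union> R 1 \<union> R 2 = UNIV"
      unfolding R_def set_eq_iff by (simp; presburger)
    finally show ?thesis using e_sum has_sum_unique S2 by metis
  qed

  define G where "G = (\<lambda>((a, b), (c, d)). e a * e b * (e c * e d))"
  define K where "K = (\<lambda>(c, d). (R c \<times> R d) \<times> (R (- c - d) \<times> R (d - c)))"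
  define I where "I = {0, 1, 2 :: int} \<times> {0, 1, 2 :: int}"
  \<comment> \<open>\<open>K (c, d)\<close> is the residue class of the codeword \<open>(c, d, -c-d, d-c)\<close> of the tetracode.\<close>
  define L where "L = {((a, b), (c, d)) | a b c d :: int. 3 dvd a + b + c \<and> 3 dvd a - b + d}"
  have GK: "(G has_sum (S c * S d * (S (- c - d) * S (d - c)))) (K (c, d))" for c d
  proof -
    have "((\<lambda>(p, q). (case p of (a, b) \<Rightarrow> e a * e b) * (case q of (a, b) \<Rightarrow> e a * e b))
        has_sum (S c * S d * (S (- c - d) * S (d - c)))) (K (c, d))"
      unfolding K_def prod.case
      by (intro has_sum_times S) (auto simp: e_pos)
    then show ?thesis by (simp add: G_def case_prod_unfold)
  qed
  have "(G has_sum (\<Sum>(c, d)\<in>I. S c * S d * (S (- c - d) * S (d - c)))) (\<Union>i\<in>I. K i)"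
  proof (rule sum_has_sum)
    show "finite I" by (simp add: I_def)
    show "(G has_sum (case i of (c, d) \<Rightarrow> S c * S d * (S (- c - d) * S (d - c)))) (K i)" for i
      by (cases i) (simp only: prod.case GK)
    fix i j assume ij: "i \<in> I" "j \<in> I" "i \<noteq> j"
    obtain a b a' b' where eq: "i = (a, b)" "j = (a', b')" by (cases i; cases j)
    have disj: "R c \<inter> R c' = {}" if "c \<noteq> c'" "c \<in> {0, 1, 2}" "c' \<in> {0, 1, 2}" for c c'
      using that unfolding R_def by (simp add: set_eq_iff) presburger
    have "R a \<inter> R a' = {} \<or> R b \<inter> R b' = {}"
      using ij disj[of a a'] disj[of b b'] unfolding eq I_def by blast
    then show "K i \<inter> K j = {}" unfolding eq K_def prod.case by blast
  qed
  also have "(\<Union>i\<in>I. K i) = L"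
  proof (intro equalityI subsetI)
    fix z assume "z \<in> (\<Union>i\<in>I. K i)"
    then obtain i j where "z \<in> K (i, j)" by (metis UN_E surj_pair)
    then obtain a b c d where z: "z = ((a, b), (c, d))"
      "3 dvd a - i" "3 dvd b - j" "3 dvd c - (- i - j)" "3 dvd d - (j - i)"
      unfolding K_def R_def by blast
    have "3 dvd a + b + c" "3 dvd a - b + d" using z(2-) by presburger+
    then show "z \<in> L" unfolding z(1) L_def by blast
  next
    fix z assume "z \<in> L"
    then obtain a b c d where z: "z = ((a, b), (c, d))" "3 dvd a + b + c" "3 dvd a - b + d"
      unfolding L_def by blast
    have mem: "x mod 3 \<in> {0, 1, 2}" for x :: int
      unfolding insert_iff empty_iff by presburger
    have "3 dvd a - a mod 3" "3 dvd b - b mod 3"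
      "3 dvd c - (- (a mod 3) - b mod 3)" "3 dvd d - (b mod 3 - a mod 3)"
      using z(2,3) by presburger+
    then have "z \<in> K (a mod 3, b mod 3)" unfolding z(1) K_def R_def by blast
    then show "z \<in> (\<Union>i\<in>I. K i)" unfolding I_def using mem by blast
  qed
  \<comment> \<open>The zero codeword contributes \<open>S 0 ^ 4\<close>. Each of the other eight
    has exactly one zero coordinate and contributes \<open>S 0 * S 1 ^ 3\<close>.\<close>
  also have "(\<Sum>(c, d)\<in>I. S c * S d * (S (- c - d) * S (d - c))) = S 0 ^ 4 + 8 * S 0 * S 1 ^ 3"
  proof -
    have "S (-1) = S 1" "S (-2) = S 1" "S (-3) = S 0" "S (-4) = S 1"
      using S2 S_mod[of "-1"] S_mod[of "-2"] S_mod[of "-3"] S_mod[of "-4"] by simp_all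
    then show ?thesis
      unfolding I_def sum.cartesian_product[symmetric]
      by (simp add: S2 power_eq_if mult_ac)
  qed
  finally have GL: "(G has_sum (S 0 ^ 4 + 8 * S 0 * S 1 ^ 3)) L" .

  define h where "h = (\<lambda>n::int. exp (- (3 * x * (real_of_int n)\<^sup>2)))"
  define H where "H = (\<lambda>((a, b), (c, d)). h a * h b * (h c * h d))"
  let ?F = "ramanujan_phi (exp (- (3 * x)))"
  have h: "(h has_sum ?F) UNIV" unfolding h_def using assms(1) by (intro has_sum_ramanujan_phi) simp
  have "((\<lambda>(p, q). (case p of (a, b) \<Rightarrow> h a * h b) * (case q of (a, b) \<Rightarrow> h a * h b))
      has_sum (?F * ?F * (?F * ?F))) ((UNIV \<times> UNIV) \<times> (UNIV \<times> UNIV))"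
    by (intro has_sum_times h) (auto simp: h_def)
  then have "(H has_sum (?F ^ 4)) UNIV"
    by (simp add: H_def case_prod_unfold power_eq_if mult_ac)
  also have "(H has_sum (?F ^ 4)) UNIV = (G has_sum (?F ^ 4)) L"
  proof -
    define M :: "(int \<times> int) \<times> int \<times> int \<Rightarrow> (int \<times> int) \<times> int \<times> int"
      where "M = (\<lambda>((a, b), (c, d)). ((a + b + c, a - b + d), (a - c - d, b - c + d)))"
    define M' :: "(int \<times> int) \<times> int \<times> int \<Rightarrow> (int \<times> int) \<times> int \<times> int"
      where "M' = (\<lambda>((a, b), (c, d)).
        (((a + b + c) div 3, (a - b + d) div 3), ((a - c - d) div 3, (b - c + d) div 3)))"
    \<comment> \<open>The matrix of \<open>M\<close> is 3 times its own inverse transpose.\<close>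
    have M: "M ((a, b), (c, d)) = ((a + b + c, a - b + d), (a - c - d, b - c + d))" for a b c d
      by (simp add: M_def)
    have M': "M' ((a, b), (c, d)) =
        (((a + b + c) div 3, (a - b + d) div 3), ((a - c - d) div 3, (b - c + d) div 3))" for a b c d
      by (simp add: M'_def)
    have exp_eq: "exp (- (x * A)) * exp (- (x * B)) * (exp (- (x * C)) * exp (- (x * D))) =
        exp (- (3 * x * A')) * exp (- (3 * x * B')) * (exp (- (3 * x * C')) * exp (- (3 * x * D')))"
      if "A + B + (C + D) = 3 * (A' + B' + (C' + D'))" for A B C D A' B' C' D' :: real
    proof -
      have "- (x * A) + - (x * B) + (- (x * C) + - (x * D)) = - (x * (A + B + (C + D)))"
        by (simp add: algebra_simps)
      then show ?thesis unfolding mult_exp_exp that by (simp add: algebra_simps)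
    qed
    have GM: "G (M z) = H z" for z
    proof -
      obtain a b c d where z: "z = ((a, b), (c, d))" by (metis surj_pair)
      \<comment> \<open>The rows of \<open>M\<close> are orthogonal of squared length 3, so
        \<open>M\<close> triples the squared norm; this matches the exponent \<open>3 * x\<close> in
        \<open>h\<close>.\<close>
      have "(real_of_int (a + b + c))\<^sup>2 + (real_of_int (a - b + d))\<^sup>2 +
          ((real_of_int (a - c - d))\<^sup>2 + (real_of_int (b - c + d))\<^sup>2) =
          3 * ((real_of_int a)\<^sup>2 + (real_of_int b)\<^sup>2 + ((real_of_int c)\<^sup>2 + (real_of_int d)\<^sup>2))"
        by (simp add: power2_eq_square algebra_simps)
      then show ?thesis
        unfolding z M G_def H_def e_def h_def prod.case by (rule exp_eq)
    qed
    have M_in: "M z \<in> L" for z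
    proof -
      obtain a b c d where z: "z = ((a, b), (c, d))" by (metis surj_pair)
      have "3 dvd (a + b + c) + (a - b + d) + (a - c - d)"
        "3 dvd (a + b + c) - (a - b + d) + (b - c + d)"
        by presburger+
      then show ?thesis unfolding z M L_def by blast
    qed
    have M'M: "M' (M z) = z" for z
    proof -
      obtain a b c d where z: "z = ((a, b), (c, d))" by (metis surj_pair)
      have eq: "(a + b + c) + (a - b + d) + (a - c - d) = 3 * a"
        "(a + b + c) - (a - b + d) + (b - c + d) = 3 * b"
        "(a + b + c) - (a - c - d) - (b - c + d) = 3 * c"
        "(a - b + d) - (a - c - d) + (b - c + d) = 3 * d" by linarith+
      show ?thesis unfolding z M M' eq by simp
    qed
    have MM': "M (M' z) = z" if "z \<in> L" for z
    proof -
      from that obtain a b c d where z: "z = ((a, b), (c, d))" "3 dvd a + b + c" "3 dvd a - b + d"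
        unfolding L_def by blast
      \<comment> \<open>Modulo 3 the last two rows of \<open>M\<close> are combinations of the first
        two, so they vanish on \<open>L\<close> as well.\<close>
      have "3 dvd a - c - d" "3 dvd b - c + d" using z(2,3) by presburger+
      with z(2,3) obtain a' b' c' d' where eq:
        "a + b + c = 3 * a'" "a - b + d = 3 * b'" "a - c - d = 3 * c'" "b - c + d = 3 * d'"
        unfolding dvd_def by blast
      then have "a' + b' + c' = a" "a' - b' + d' = b" "a' - c' - d' = c" "b' - c' + d' = d"
        by linarith+
      then show ?thesis unfolding z(1) M' eq by (simp add: M)
    qed
    show ?thesis
      by (rule has_sum_reindex_bij_witness[of _ M' M]) (auto simp: GM M_in M'M MM')
  qed
  finally have "?F ^ 4 = S 0 ^ 4 + 8 * S 0 * S 1 ^ 3"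
    using GL has_sum_unique by blast
  then show ?thesis unfolding P S0 by (simp add: power_eq_if algebra_simps)
qed

text \<open>Dividing the quartic relation by P^4 gives a polynomial in r = Q/P; multiplied by 9 and
  lowered by 1 it is exactly the cube of 3r - 1.\<close>

lemma ramanujan_phi_cubic:
  fixes x :: real
  assumes "x > 0"
  defines "P \<equiv> ramanujan_phi (exp (- x))"
    and "Q \<equiv> ramanujan_phi (exp (- (9 * x)))"
    and "F \<equiv> ramanujan_phi (exp (- (3 * x)))"
  shows "(3 * (Q / P) - 1) ^ 3 = 9 * (F / P) ^ 4 - 1"
proof -
  have "P > 0" unfolding P_def using assms(1) by (rule ramanujan_phi_pos)
  have F: "F ^ 4 = Q * (Q ^ 3 + (P - Q) ^ 3)"
    unfolding P_def Q_def F_def by (rule ramanujan_phi_quartic[OF assms(1)])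
  define r where "r = Q / P"
  have Q: "Q = r * P" using \<open>P > 0\<close> by (simp add: r_def)
  have "Q * (Q ^ 3 + (P - Q) ^ 3) = r * (r ^ 3 + (1 - r) ^ 3) * P ^ 4"
    unfolding Q by algebra
  then have "(F / P) ^ 4 = r * (r ^ 3 + (1 - r) ^ 3)"
    unfolding power_divide F using \<open>P > 0\<close> by (simp add: field_simps)
  moreover have "(3 * r - 1) ^ 3 = 9 * (r * (r ^ 3 + (1 - r) ^ 3)) - 1" by algebra
  ultimately show ?thesis by (simp add: r_def)
qed

section \<open>Evaluation of the ratio\<close>

lemma cube_eq_iff: "a ^ 3 = b ^ 3 \<longleftrightarrow> a = b" for a b :: real
  by (metis odd_numeral odd_real_root_power_cancel)

lemma ramanujan_phi_ratio_27_3: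
  fixes a :: real
  assumes a: "a ^ 3 = 2 * (sqrt 3 + 1)"
  shows "(3 * (ramanujan_phi (exp (- (27 * pi))) / ramanujan_phi (exp (- (3 * pi)))) - 1) ^ 3 =
    (1 + a) ^ 4 * (2 * sqrt 3 - 3) / 3 - 1"
proof -
  define c where "c = sqrt 3"
  have c: "c * c = 3" "c > 0" by (simp_all add: c_def)
  define p where "p = (\<lambda>n. ramanujan_phi (exp (- (n * pi))))"
  have p_pos: "p n > 0" if "n > 0" for n
    unfolding p_def using that by (intro ramanujan_phi_pos) simp
  have cubic: "(3 * (p (9 * n) / p n) - 1) ^ 3 = 9 * (p (3 * n) / p n) ^ 4 - 1" if "n > 0" for n
    unfolding p_def using ramanujan_phi_cubic[of "n * pi"] that by (simp add: mult.assoc)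
  define u where "u = p 1 / p 3"
  define r where "r = p 9 / p 1"
  have p13: "p (1 / 3) = c * p 3"
    using ramanujan_phi_inversion[of 3] by (simp add: p_def c_def mult.commute)
  \<comment> \<open>At n = 1/3 the inversion makes the ratio Q/P equal to 1/c, so the left side of
    the cubic identity is the known number (c-1)^3 and the right side is u^4 - 1.\<close>
  have u4: "u ^ 4 = 6 * c - 9"
  proof -
    have "3 * (p 3 / (c * p 3)) = c" using c p_pos[of 3] by (simp add: field_simps)
    moreover have "9 * (p 1 / (c * p 3)) ^ 4 = u ^ 4"
    proof -
      have "c ^ 4 = 9" using c(1) by (simp add: power4_eq_xxxx)
      then show ?thesis using p_pos[of 3] by (simp add: u_def power_divide power_mult_distrib)
    qed
    ultimately have "(c - 1) ^ 3 = u ^ 4 - 1"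
      using cubic[of "1 / 3"] p13 by simp
    then show ?thesis using c(1) by algebra
  qed
  \<comment> \<open>At n = 1 the right side is 9/u^4 - 1 = 2c + 2, which is the cube of
    \<open>a\<close>.\<close>
  have r: "3 * r - 1 = a"
  proof -
    have "(p 3 / p 1) ^ 4 = 1 / u ^ 4" by (simp add: u_def power_divide)
    then have "(3 * r - 1) ^ 3 = 9 / u ^ 4 - 1"
      using cubic[of 1] by (simp add: r_def)
    also have "9 / u ^ 4 = 2 * c + 3"
    proof -
      have "u ^ 4 \<noteq> 0" using p_pos[of 1] p_pos[of 3] by (simp add: u_def)
      moreover have "(2 * c + 3) * u ^ 4 = 12 * (c * c) - 27" unfolding u4 by (simp add: algebra_simps)
      ultimately show ?thesis using c(1) by (simp add: field_simps)
    qed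
    finally have "(3 * r - 1) ^ 3 = a ^ 3" using a by (simp add: c_def)
    then show ?thesis by (simp only: cube_eq_iff)
  qed
  \<comment> \<open>This quotient is what the right side of the cubic identity needs at n =
    3.\<close>
  have "p 9 / p 3 = r * u" using p_pos[of 1] by (simp add: r_def u_def)
  then have "(3 * (p 27 / p 3) - 1) ^ 3 = 9 * (r ^ 4 * u ^ 4) - 1"
    using cubic[of 3] by (simp add: power_mult_distrib)
  also have "\<dots> = (1 + a) ^ 4 * (2 * c - 3) / 3 - 1"
  proof -
    have "r = (1 + a) / 3" using r by simp
    then have "r ^ 4 = (1 + a) ^ 4 / 81" by (simp only: power_divide) simp
    then show ?thesis unfolding u4 by (simp add: field_simps)
  qed
  finally show ?thesis by (simp add: p_def c_def)
qed

section \<open>Denesting of the sum of three cube roots\<close>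

lemma cos_ninths:
  defines "v1 \<equiv> 2 * cos (4 * pi / 9)" and "v2 \<equiv> 2 * cos (2 * pi / 9)" and "v3 \<equiv> - (2 * cos (pi / 9))"
  shows "v1 + v2 + v3 = 0" "v1 * v2 + v1 * v3 + v2 * v3 = - 3" "v1 * v2 * v3 = - 1"
proof -
  \<comment> \<open>The three numbers are 2 cos t with cos(3t) = -1/2, hence the roots of v^3 - 3v +
    1. Here everything is reduced to \<open>C\<close> and its cubic equation.\<close>
  define C where "C = cos (pi / 9)"
  have cubic: "4 * C ^ 3 - 3 * C = 1 / 2"
    using cos_treble_cos[of "pi / 9"] by (simp add: C_def cos_60)
  have c2: "cos (2 * pi / 9) = 2 * C\<^sup>2 - 1"
    using cos_double_cos[of "pi / 9"] by (simp add: C_def)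
  have "cos (4 * pi / 9) = 2 * (2 * C\<^sup>2 - 1)\<^sup>2 - 1"
    using cos_double_cos[of "2 * pi / 9"] by (simp add: c2)
  also have "\<dots> = 1 + C - 2 * C\<^sup>2" using cubic by algebra
  finally have c4: "cos (4 * pi / 9) = 1 + C - 2 * C\<^sup>2" .
  note defs = v1_def v2_def v3_def c2 c4 C_def[symmetric]
  show "v1 + v2 + v3 = 0" unfolding defs by simp
  show "v1 * v2 + v1 * v3 + v2 * v3 = - 3" unfolding defs using cubic by algebra
  show "v1 * v2 * v3 = - 1" unfolding defs using cubic by algebra
qed

lemma sum_cube_roots:
  fixes a :: real
  assumes a: "a ^ 3 = 2 * (sqrt 3 + 1)" "a > 0"
  shows "(root 3 (1 + sqrt 3 / (2 * cos (4 * pi / 9)))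
      + root 3 (1 + sqrt 3 / (2 * cos (2 * pi / 9)))
      + root 3 (1 - sqrt 3 / (2 * cos (pi / 9)))) ^ 3 = 3 * sqrt 3 + 9 + 9 * a + 9 / 2 * a\<^sup>2"
proof -
  define c where "c = sqrt 3"
  have c: "c * c = 3" "c > 0" by (simp_all add: c_def)
  define v1 v2 v3 where v: "v1 = 2 * cos (4 * pi / 9)" "v2 = 2 * cos (2 * pi / 9)"
    "v3 = - (2 * cos (pi / 9))"
  note vieta = cos_ninths[folded v]
  have v_sign: "v1 > 0" "v2 > 0" "c < - v3"
  proof -
    show "v1 > 0" "v2 > 0" unfolding v by (auto intro!: cos_gt_zero)
    \<comment> \<open>This is what makes the third radicand positive, since its subtracted fraction
      is then below 1.\<close>
    have "cos (pi / 6) < cos (pi / 9)" by (rule cos_monotone_0_pi) auto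
    then show "c < - v3" unfolding v c_def by (simp add: cos_30)
  qed
  define u1 u2 u3 where u: "u1 = 1 + c / v1" "u2 = 1 + c / v2" "u3 = 1 + c / v3"
  have u_pos: "u1 > 0" "u2 > 0" "u3 > 0"
    using v_sign c by (auto simp: u field_simps add_pos_pos)
  \<comment> \<open>The reciprocals are the roots of w^3 - 3w^2 + 1, and the radicands depend on
    them affinely.\<close>
  define w1 w2 w3 where w: "w1 = 1 / v1" "w2 = 1 / v2" "w3 = 1 / v3"
  have w_vieta: "w1 + w2 + w3 = 3" "w1 * w2 + w1 * w3 + w2 * w3 = 0" "w1 * w2 * w3 = - 1"
  proof -
    have ne: "v1 \<noteq> 0" "v2 \<noteq> 0" "v3 \<noteq> 0" using v_sign c by auto
    then have eq: "w1 * v1 = 1" "w2 * v2 = 1" "w3 * v3 = 1" by (simp_all add: w)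
    show "w1 * w2 * w3 = - 1" using eq vieta(3) by algebra
    show "w1 + w2 + w3 = 3" using eq vieta(2,3) by algebra
    show "w1 * w2 + w1 * w3 + w2 * w3 = 0" using eq vieta(1,3) by algebra
  qed
  have u_w: "u1 = 1 + c * w1" "u2 = 1 + c * w2" "u3 = 1 + c * w3" by (simp_all add: u w)
  have u_vieta: "u1 + u2 + u3 = 3 + 3 * c" "u1 * u2 + u1 * u3 + u2 * u3 = 3 + 6 * c" "u1 * u2 * u3 = 1"
  proof -
    have "u1 + u2 + u3 = 3 + c * (w1 + w2 + w3)"
      unfolding u_w by (simp add: algebra_simps)
    then show "u1 + u2 + u3 = 3 + 3 * c" by (simp add: w_vieta)
    have "u1 * u2 + u1 * u3 + u2 * u3 =
        3 + 2 * c * (w1 + w2 + w3) + c * c * (w1 * w2 + w1 * w3 + w2 * w3)"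
      unfolding u_w by (simp add: algebra_simps)
    then show "u1 * u2 + u1 * u3 + u2 * u3 = 3 + 6 * c" by (simp add: w_vieta)
    have "u1 * u2 * u3 = 1 + c * (w1 + w2 + w3) + c * c * (w1 * w2 + w1 * w3 + w2 * w3)
        + c * c * c * (w1 * w2 * w3)"
      unfolding u_w by (simp add: algebra_simps)
    then show "u1 * u2 * u3 = 1" by (simp add: w_vieta c(1))
  qed
  define y1 y2 y3 where y: "y1 = root 3 u1" "y2 = root 3 u2" "y3 = root 3 u3"
  have y_pos: "y1 > 0" "y2 > 0" "y3 > 0" using u_pos by (simp_all add: y)
  have y3: "y1 ^ 3 = u1" "y2 ^ 3 = u2" "y3 ^ 3 = u3" by (simp_all add: y odd_real_root_pow)
  have "(y1 * y2 * y3) ^ 3 = 1 ^ 3" using u_vieta(3) by (simp add: power_mult_distrib y3)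
  then have prod: "y1 * y2 * y3 = 1" by (simp only: cube_eq_iff)
  define S where "S = y1 + y2 + y3"
  define P where "P = y1 * y2 + y1 * y3 + y2 * y3"
  define T where "T = S * P"
  have S3: "S ^ 3 = 3 * c + 3 * T"
  proof -
    have "S ^ 3 = y1 ^ 3 + y2 ^ 3 + y3 ^ 3 + 3 * T - 3 * (y1 * y2 * y3)"
      unfolding S_def T_def P_def by algebra
    then show ?thesis using u_vieta(1) by (simp add: prod y3)
  qed
  have P3: "P ^ 3 = 6 * c + 3 * T"
  proof -
    have "P ^ 3 = y1 ^ 3 * y2 ^ 3 + y1 ^ 3 * y3 ^ 3 + y2 ^ 3 * y3 ^ 3
        + 3 * T * (y1 * y2 * y3) - 3 * (y1 * y2 * y3)\<^sup>2"
      unfolding S_def T_def P_def by algebra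
    then show ?thesis using u_vieta(2) by (simp add: prod y3)
  qed
  \<comment> \<open>Cardano's formula after the shift T = 3 + U: the two parts 3a and 3a^2/2 of U
    have product 9a^3/2 = 9(c+1), as the linear coefficient demands.\<close>
  define T0 where "T0 = 3 + 3 * a + 3 / 2 * a\<^sup>2"
  \<comment> \<open>Multiply the formulas for S^3 and P^3: T^3 = (3c + 3T)(6c + 3T).\<close>
  have T: "T * (T\<^sup>2 - 9 * T - 27 * c) = 54" using S3 P3 c(1) unfolding T_def by algebra
  have T0: "T0 * (T0\<^sup>2 - 9 * T0 - 27 * c) = 54"
    using a(1) c(1) unfolding T0_def c_def[symmetric] by algebra
  have pos: "T > 0" "T0 > 0"
    unfolding T_def S_def P_def T0_def using y_pos a(2) by (auto intro!: mult_pos_pos add_pos_pos)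
  \<comment> \<open>For a second positive root the cofactor of T - T0 would vanish. Its first part
    is 54/T > 0, which forces T > 9 and makes the second part positive too.\<close>
  have "T = T0"
  proof (rule ccontr)
    assume "T \<noteq> T0"
    have "(T - T0) * ((T\<^sup>2 - 9 * T - 27 * c) + T0 * (T + T0 - 9)) =
        T * (T\<^sup>2 - 9 * T - 27 * c) - T0 * (T0\<^sup>2 - 9 * T0 - 27 * c)"
      by (simp add: power2_eq_square algebra_simps)
    then have zero: "(T\<^sup>2 - 9 * T - 27 * c) + T0 * (T + T0 - 9) = 0"
      using \<open>T \<noteq> T0\<close> by (simp add: T T0)
    have "T\<^sup>2 - 9 * T - 27 * c > 0" using T pos by (metis zero_less_mult_pos zero_less_numeral)
    moreover from this have "T * (T - 9) > 0" using c by (simp add: power2_eq_square algebra_simps)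
    then have "T > 9" using pos zero_less_mult_pos by force
    then have "T0 * (T + T0 - 9) > 0" using pos by simp
    ultimately show False using zero by simp
  qed
  then have "S ^ 3 = 3 * c + 9 + 9 * a + 9 / 2 * a\<^sup>2" using S3 by (simp add: T0_def)
  then show ?thesis by (simp add: S_def y u v c_def)
qed

theorem theorem4p9:
  "ramanujan_phi (exp (- 27 * pi)) / ramanujan_phi (exp (- 3 * pi)) =
     1 / 3 * (1 + root 9 (16 * (11 * sqrt 3 - 19)) / sqrt 3 *
       (root 3 (1 + sqrt 3 / (2 * cos (4 * pi / 9)))
      + root 3 (1 + sqrt 3 / (2 * cos (2 * pi / 9)))
      + root 3 (1 - sqrt 3 / (2 * cos (pi / 9)))))"
proof -
  define c where "c = sqrt 3"
  have c: "c * c = 3" "c > 0" by (simp_all add: c_def)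
  define a where "a = root 3 (2 * (c + 1))"
  have a3: "a ^ 3 = 2 * (c + 1)" by (simp add: a_def odd_real_root_pow)
  have a_pos: "a > 0" using c by (simp add: a_def)
  define k where "k = root 9 (16 * (11 * c - 19))"
  \<comment> \<open>The ninth root is simplified through (2-c)^3 = 26 - 15c, which exhibits its
    radicand as a cube times a^3.\<close>
  have "(k ^ 3) ^ 3 = (2 * (2 - c) * a) ^ 3"
  proof -
    have "(k ^ 3) ^ 3 = k ^ 9" by simp
    also have "\<dots> = 16 * (11 * c - 19)" by (simp add: k_def odd_real_root_pow)
    also have "\<dots> = (2 * (2 - c) * a) ^ 3"
    proof -
      have "(2 - c) ^ 3 = 8 - 12 * c + 6 * (c * c) - c * c * c"
        by (simp add: power3_eq_cube algebra_simps)
      then have cube: "(2 - c) ^ 3 = 26 - 15 * c" using c(1) by simp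
      have "(2 * (2 - c) * a) ^ 3 = 16 * (26 + 11 * c - 15 * (c * c))"
        unfolding power_mult_distrib a3 cube by (simp add: algebra_simps)
      then show ?thesis using c(1) by simp
    qed
    finally show ?thesis .
  qed
  then have k3: "k ^ 3 = 2 * (2 - c) * a" by (simp only: cube_eq_iff)
  define S where "S = root 3 (1 + sqrt 3 / (2 * cos (4 * pi / 9)))
      + root 3 (1 + sqrt 3 / (2 * cos (2 * pi / 9)))
      + root 3 (1 - sqrt 3 / (2 * cos (pi / 9)))"
  have S3: "S ^ 3 = 3 * c + 9 + 9 * a + 9 / 2 * a\<^sup>2"
    unfolding S_def c_def using a3 a_pos by (intro sum_cube_roots) (simp_all add: c_def)
  define X where "X = 3 * (ramanujan_phi (exp (- (27 * pi))) / ramanujan_phi (exp (- (3 * pi)))) - 1"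
  have X3: "X ^ 3 = (1 + a) ^ 4 * (2 * c - 3) / 3 - 1"
    unfolding X_def c_def using a3 by (intro ramanujan_phi_ratio_27_3) (simp add: c_def)
  have "(k / c * S) ^ 3 = k ^ 3 * S ^ 3 / (3 * c)"
    using c by (simp add: power_mult_distrib power_divide power3_eq_cube)
  also have "\<dots> = X ^ 3"
  proof -
    \<comment> \<open>A polynomial identity in \<open>a\<close> and \<open>c\<close> modulo a^3 =
      2(c+1) and c^2 = 3; comparing real cubes then gives X itself.\<close>
    have "k ^ 3 * S ^ 3 = X ^ 3 * (3 * c)"
      unfolding k3 S3 X3 using a3 c(1) by algebra
    then show ?thesis using c by simp
  qed
  finally have "X = k / c * S" by (simp only: cube_eq_iff)
  moreover have "R = 1 / 3 * (1 + y)" if "3 * R - 1 = y" for R y :: real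
    unfolding that[symmetric] by simp
  ultimately have "ramanujan_phi (exp (- (27 * pi))) / ramanujan_phi (exp (- (3 * pi))) =
      1 / 3 * (1 + k / c * S)"
    unfolding X_def by blast
  then show ?thesis by (simp only: S_def k_def c_def mult_minus_left)
qed

end
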